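(* Let $p$ be an odd prime, $q\in\mathbb{C}_p$ with $|1-q|_p<p^{-1/(p-1)}$, let $d$ be a positive odd integer, $\alpha,\beta\in\mathbb{Z}_+$ and $n\in\mathbb{N}$. Then \[ g^{(\alpha,\beta)}_{n,q}(dx)=\frac{[d]_{q^{\alpha}}^{\,n-1}}{[d]_{-q^{\beta}}}\sum_{a=0}^{d-1}(-1)^a\,g^{(\alpha,\beta)}_{n,q^d}\!\left(x+\frac{a}{d}\right). \]
   Context: $\mathbb{Z}_+=\mathbb{N}\cup\{0\}$. For $q\in\mathbb{C}_p$ with $|1-q|_p<p^{-1/(p-1)}$, $q^x=\exp(x\log q)$ for $|x|_p\le1$, $[x]_q=\frac{1-q^x}{1-q}$, $[x]_{-q}=\frac{1-(-q)^x}{1+q}$. For uniformly differentiable $f:\mathbb{Z}_p\to\mathbb{C}_p$, $\int_{\mathbb{Z}_p}f(x)\,d\mu_{-q}(x)=\lim_{N\to\infty}\frac{1}{[p^N]_{-q}}\sum_{x=0}^{p^N-1}f(x)(-q)^x$; $d\mu_{-q^\beta}$ is the same with $q$ replaced by $q^\beta$. The modified $q$-Genocchi polynomials with weight $(\alpha,\beta)$ are defined by $\frac{g^{(\alpha,\beta)}_{n+1,q}(x)}{n+1}=\int_{\mathbb{Z}_p}q^{-\beta t}[x+t]_{q^{\alpha}}^{n}\,d\mu_{-q^{\beta}}(t)$; $g^{(\alpha,\beta)}_{n,q^d}$ denotes the same polynomials with $q$ replaced by $q^d$. *)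

theory Defs
  imports "HOL-Analysis.Analysis" "HOL-Computational_Algebra.Polynomial"
begin

text \<open>
  Complete fields with a non-archimedean absolute value; the absolute value of \<open>x\<close> is its
  distance to \<open>0\<close>. (The class \<open>real_normed_field\<close> does not apply, since it demands a real
  vector space, and the library ties the constant \<open>norm\<close> to such spaces.)
\<close>

class complete_ultrametric_field = field_char_0 + complete_space +
  assumes dist_eq_dist_diff: "dist x y = dist (x - y) 0"
    and dist_mult_0: "dist (x * y) 0 = dist x 0 * dist y 0"
    and dist_add_0_le_max: "dist (x + y) 0 \<le> max (dist x 0) (dist y 0)"

definition absval :: "'a::complete_ultrametric_field \<Rightarrow> real" where
  "absval x = dist x 0"

text \<open>
  The field of \<open>p\<close>-adic complex numbers, as the completion of an algebraic closure of the
  completion of the rationals with respect to the \<open>p\<close>-adic absolute value. The field is the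
  whole type, whose completeness is part of the sort constraint. The absolute value is
  normalised by \<open>absval p = 1 / p\<close>; with multiplicativity and the ultrametric inequality this
  fixes it on the rationals. These conditions determine the valued field up to isometric
  isomorphism.
\<close>

definition padic_rationals :: "'a::complete_ultrametric_field set" where
  "padic_rationals = closure (range of_rat)"

definition padic_algebraic :: "'a::complete_ultrametric_field set" where
  "padic_algebraic =
     {x. \<exists>P. P \<noteq> 0 \<and> (\<forall>i. coeff P i \<in> padic_rationals) \<and> poly P x = 0}"

locale padic_complex_field =
  fixes field_type :: "'a::complete_ultrametric_field itself"
    and p :: nat
  assumes prime_p: "prime p"
    and absval_p: "absval (of_nat p :: 'a) = 1 / real p"
    and algebraically_closed:
      "(\<forall>i. coeff P i \<in> (padic_algebraic :: 'a set)) \<Longrightarrow> degree P > 0 \<Longrightarrow>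
         \<exists>z \<in> padic_algebraic. poly P z = 0"
    and algebraic_dense: "closure (padic_algebraic :: 'a set) = UNIV"

text \<open>The library functions \<open>exp\<close> and \<open>ln\<close> are restricted to real normed algebras.\<close>

definition padic_exp :: "'a::complete_ultrametric_field \<Rightarrow> 'a" where
  "padic_exp z = (\<Sum>k. z ^ k / fact k)"

definition padic_log :: "'a::complete_ultrametric_field \<Rightarrow> 'a" where
  "padic_log z = (\<Sum>k. (-1) ^ k * (z - 1) ^ Suc k / of_nat (Suc k))"

definition qpow :: "'a::complete_ultrametric_field \<Rightarrow> 'a \<Rightarrow> 'a" where
  "qpow q x = padic_exp (x * padic_log q)"

text \<open>
  The quotient is meaningless for \<open>q = 1\<close>, a base that does occur (as \<open>q ^ 0\<close>, for
  instance); there the \<open>q\<close>-number takes its limit value \<open>x\<close>.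
\<close>

definition qnumber :: "'a::complete_ultrametric_field \<Rightarrow> 'a \<Rightarrow> 'a" where
  "qnumber q x = (if q = 1 then x else (1 - qpow q x) / (1 - q))"

text \<open>
  The \<open>q\<close>-number to the base \<open>-q\<close>. Here \<open>-q\<close> is not close to \<open>1\<close>, so the exponent is a
  natural number and the power is the algebraic one.
\<close>

definition qnumber_neg :: "'a::field_char_0 \<Rightarrow> nat \<Rightarrow> 'a" where
  "qnumber_neg q k = (1 - (- q) ^ k) / (1 + q)"

text \<open>The integral of \<open>f\<close> over the \<open>p\<close>-adic integers with respect to \<open>\<mu>\<close> to the base \<open>-q\<close>.\<close>

definition fermionic_integral ::
    "nat \<Rightarrow> 'a::complete_ultrametric_field \<Rightarrow> ('a \<Rightarrow> 'a) \<Rightarrow> 'a" where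
  "fermionic_integral p q f =
     lim (\<lambda>N. 1 / qnumber_neg q (p ^ N) * (\<Sum>t<p ^ N. f (of_nat t) * (- q) ^ t))"

text \<open>
  The modified \<open>q\<close>-Genocchi polynomials with weight \<open>(\<alpha>, \<beta>)\<close>. Only positive indices are
  specified by the integral; the value at index \<open>0\<close> is the usual convention.
\<close>

primrec q_genocchi ::
    "nat \<Rightarrow> nat \<Rightarrow> nat \<Rightarrow> 'a::complete_ultrametric_field \<Rightarrow> nat \<Rightarrow> 'a \<Rightarrow> 'a" where
  "q_genocchi p \<alpha> \<beta> q 0 x = 0"
| "q_genocchi p \<alpha> \<beta> q (Suc n) x =
     of_nat (Suc n) *
     fermionic_integral p (q ^ \<beta>)
       (\<lambda>t. qpow q (- (of_nat \<beta> * t)) * qnumber (q ^ \<alpha>) (x + t) ^ n)"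

end

theory Submission
  imports Defs "HOL-Computational_Algebra.Formal_Power_Series"
begin

text \<open>
  The weight \<open>q\<^sup>-\<^sup>\<beta>\<^sup>t\<close> cancels the measure up to sign, so the integral defining the Genocchi
  polynomial is \<open>(1 + q ^ \<beta>) / 2\<close> times the limit of the alternating sums of
  \<open>g s = [d x + s] ^ (n - 1)\<close> over \<open>s < p ^ N\<close>. Since \<open>g\<close> is Lipschitz for the \<open>p\<close>-adic absolute
  value and \<open>p ^ N\<close> is odd, the alternating sum over \<open>s < m * p ^ N\<close> has the same limit for every
  odd \<open>m\<close>: the case \<open>m = p\<close> makes the sums converge, and the case \<open>m = d\<close>, with \<open>s\<close> split into
  residue classes \<open>a + d t\<close> and \<open>[d y]\<close> factored as \<open>[d]\<close> times the number of \<open>y\<close> to the base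
  \<open>q ^ d\<close>, is the multiplication formula. This rests on \<open>exp (log q) = q\<close> and \<open>log (q ^ m) = m log q\<close>
  on the disc where the exponential converges.
\<close>

unbundle no vec_syntax
unbundle fps_syntax

section \<open>Ultrametric absolute values\<close>

lemma dist_eq_absval: "dist x y = absval (x - y)"
  unfolding absval_def by (rule dist_eq_dist_diff)

lemma absval_nonneg [simp]: "absval x \<ge> 0"
  by (simp add: absval_def)

lemma absval_0 [simp]: "absval 0 = 0"
  by (simp add: absval_def)

lemma absval_eq_0_iff [simp]: "absval x = 0 \<longleftrightarrow> x = 0"
  by (simp add: absval_def)

lemma absval_le_0_iff [simp]: "absval x \<le> 0 \<longleftrightarrow> x = 0"
  by (simp add: absval_def)

lemma absval_mult: "absval (x * y) = absval x * absval y"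
  by (simp add: absval_def dist_mult_0)

lemma absval_1 [simp]: "absval (1 :: 'a::complete_ultrametric_field) = 1"
proof -
  have "absval (1::'a) * absval (1::'a) = absval (1::'a)"
    using absval_mult[of "1::'a" 1] by simp
  thus ?thesis by simp
qed

lemma absval_power: "absval (x ^ n) = absval x ^ n"
  by (induction n) (simp_all add: absval_mult)

lemma absval_minus [simp]: "absval (- x) = absval (x :: 'a::complete_ultrametric_field)"
proof -
  have "absval (- 1 :: 'a) ^ 2 = 1"
    using absval_power[of "- 1 :: 'a" 2] by simp
  hence "absval (- 1 :: 'a) = 1"
    using absval_nonneg[of "- 1 :: 'a"] by (simp add: power2_eq_1_iff)
  thus ?thesis
    using absval_mult[of "- 1" x] by simp
qed

lemma absval_minus_commute: "absval (x - y) = absval (y - x)"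
  using absval_minus[of "x - y"] by simp

lemma absval_add_le: "absval (x + y) \<le> max (absval x) (absval y)"
  using dist_add_0_le_max by (simp add: absval_def)

lemma absval_add_leI: "absval x \<le> C \<Longrightarrow> absval y \<le> C \<Longrightarrow> absval (x + y) \<le> C"
  using absval_add_le[of x y] by linarith

lemma absval_diff_leI: "absval x \<le> C \<Longrightarrow> absval y \<le> C \<Longrightarrow> absval (x - y) \<le> C"
  using absval_add_leI[of x C "- y"] by simp

text \<open>Since x = (x + y) - y and y is too small to account for x, the sum must be as large as
  x. This dominance principle later yields |q| = 1, |exp z| = 1 and |1 + q| = 1.\<close>

lemma absval_add_eq:
  assumes "absval y < absval x"
  shows "absval (x + y) = absval x"
  using absval_add_le[of x y] absval_add_le[of "x + y" "- y"] assms by simp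

lemma absval_inverse: "absval (inverse x) = inverse (absval x)"
proof (cases "x = 0")
  case False
  thus ?thesis using absval_mult[of x "inverse x"] by (simp add: field_simps)
qed simp

lemma absval_divide: "absval (x / y) = absval x / absval y"
  by (simp add: divide_inverse absval_mult absval_inverse)

lemma absval_sum_le:
  assumes "\<And>i. i \<in> A \<Longrightarrow> absval (f i) \<le> C" "0 \<le> C"
  shows "absval (\<Sum>i\<in>A. f i) \<le> C"
  using assms by (induction A rule: infinite_finite_induct) (auto intro: absval_add_leI)

lemma absval_of_nat_le_1: "absval (of_nat n) \<le> 1"
  by (induction n) (auto intro: absval_add_leI)

lemma absval_of_int_le_1: "absval (of_int i) \<le> 1"
  by (cases i rule: int_cases2) (auto simp: absval_of_nat_le_1)

lemma absval_power_minus1 [simp]: "absval ((- 1) ^ n) = 1"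
  by (simp add: absval_power)

text \<open>The cofactor of x - y is a sum of monomials of degree n - 1, and an ultrametric sum is
  no larger than its largest term, so no factor n appears.\<close>

lemma absval_power_diff_le:
  assumes "absval x \<le> R" "absval y \<le> R"
  shows "absval (x ^ n - y ^ n) \<le> absval (x - y) * R ^ (n - 1)"
proof -
  have R: "R \<ge> 0" using assms(1) absval_nonneg[of x] by linarith
  have "absval (\<Sum>i<n. y ^ (n - Suc i) * x ^ i) \<le> R ^ (n - 1)"
  proof (rule absval_sum_le)
    fix i assume i: "i \<in> {..<n}"
    have "absval (y ^ (n - Suc i) * x ^ i) \<le> R ^ (n - Suc i) * R ^ i"
      unfolding absval_mult absval_power
      by (intro mult_mono power_mono assms absval_nonneg zero_le_power R)
    also have "\<dots> = R ^ (n - 1)"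
      using i by (simp add: power_add [symmetric])
    finally show "absval (y ^ (n - Suc i) * x ^ i) \<le> R ^ (n - 1)" .
  qed (use R in simp)
  thus ?thesis
    using power_diff_sumr2[of x n y] by (simp add: absval_mult mult_left_mono)
qed

lemma tendsto_absval_iff: "(f \<longlongrightarrow> a) F \<longleftrightarrow> ((\<lambda>n. absval (f n - a)) \<longlongrightarrow> 0) F"
  unfolding tendsto_dist_iff[of f] dist_eq_absval ..

section \<open>Continuity of addition, negation and multiplication\<close>

instance complete_ultrametric_field \<subseteq> topological_ab_group_add
proof
  fix a b :: 'a
  have "((\<lambda>x. absval (fst x - a) + absval (snd x - b)) \<longlongrightarrow> 0 + 0) (nhds a \<times>\<^sub>F nhds b)"
    by (intro tendsto_add; unfold tendsto_absval_iff[symmetric];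
        rule filterlim_fst filterlim_snd)
  hence lim: "((\<lambda>x. absval (fst x - a) + absval (snd x - b)) \<longlongrightarrow> 0) (nhds a \<times>\<^sub>F nhds b)"
    by simp
  have "absval (fst x + snd x - (a + b)) \<le> absval (fst x - a) + absval (snd x - b)" for x
  proof -
    have "fst x + snd x - (a + b) = (fst x - a) + (snd x - b)" by simp
    also have "absval \<dots> \<le> absval (fst x - a) + absval (snd x - b)"
      by (rule absval_add_leI) auto
    finally show ?thesis .
  qed
  thus "((\<lambda>x. fst x + snd x) \<longlongrightarrow> a + b) (nhds a \<times>\<^sub>F nhds b)"
    unfolding tendsto_absval_iff by (intro tendsto_sandwich[OF _ _ tendsto_const lim]) auto
next
  fix a :: 'a
  have "((\<lambda>x. x) \<longlongrightarrow> a) (nhds a)" by (rule filterlim_ident)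
  hence "((\<lambda>x. absval (x - a)) \<longlongrightarrow> 0) (nhds a)"
    by (simp add: tendsto_absval_iff)
  thus "(uminus \<longlongrightarrow> - a) (nhds a)"
    unfolding tendsto_absval_iff by (simp add: absval_minus_commute)
qed

lemma tendsto_mult_ultrametric:
  fixes a b :: "'a::complete_ultrametric_field"
  assumes f: "(f \<longlongrightarrow> a) F" and g: "(g \<longlongrightarrow> b) F"
  shows "((\<lambda>x. f x * g x) \<longlongrightarrow> a * b) F"
proof -
  have f': "((\<lambda>x. absval (f x - a)) \<longlongrightarrow> 0) F" and g': "((\<lambda>x. absval (g x - b)) \<longlongrightarrow> 0) F"
    using f g by (simp_all add: tendsto_absval_iff)
  have "((\<lambda>x. absval (f x - a) * absval (g x - b) + absval (f x - a) * absval b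
          + absval a * absval (g x - b)) \<longlongrightarrow> 0 * 0 + 0 * absval b + absval a * 0) F"
    by (intro tendsto_intros f' g')
  hence lim: "((\<lambda>x. absval (f x - a) * absval (g x - b) + absval (f x - a) * absval b
          + absval a * absval (g x - b)) \<longlongrightarrow> 0) F"
    by simp
  have "absval (f x * g x - a * b)
      \<le> absval (f x - a) * absval (g x - b) + absval (f x - a) * absval b
          + absval a * absval (g x - b)" (is "_ \<le> ?A + ?B + ?C") for x
  proof -
    have nn: "?A \<ge> 0" "?B \<ge> 0" "?C \<ge> 0" by auto
    have "f x * g x - a * b = (f x - a) * (g x - b) + (f x - a) * b + a * (g x - b)"
      by (simp add: algebra_simps)
    also have "absval \<dots> \<le> ?A + ?B + ?C"
      by (intro absval_add_leI; unfold absval_mult; use nn in linarith)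
    finally show ?thesis .
  qed
  thus ?thesis
    unfolding tendsto_absval_iff[of _ "a * b"]
    by (intro tendsto_sandwich[OF _ _ tendsto_const lim]) auto
qed

section \<open>Series dominated by a geometric series\<close>

text \<open>Finite stretches of the tail are at most their largest term, and the bound survives the
  limit because \<open>dist\<close> is continuous.\<close>

lemma absval_suminf_diff_le:
  fixes f :: "nat \<Rightarrow> 'a::complete_ultrametric_field"
  assumes "summable f" and le: "\<And>n. n \<ge> M \<Longrightarrow> absval (f n) \<le> e" and "e \<ge> 0"
  shows "absval (suminf f - (\<Sum>n<M. f n)) \<le> e"
proof -
  have "(\<lambda>n. \<Sum>i<n. f i) \<longlonglongrightarrow> suminf f"
    using assms(1) summable_LIMSEQ by blast
  hence "(\<lambda>n. dist (\<Sum>i<n. f i) (\<Sum>n<M. f n)) \<longlonglongrightarrow> dist (suminf f) (\<Sum>n<M. f n)"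
    by (intro tendsto_intros)
  moreover have "dist (\<Sum>i<n. f i) (\<Sum>n<M. f n) \<le> e" if "n \<ge> M" for n
  proof -
    have "(\<Sum>i<n. f i) - (\<Sum>n<M. f n) = (\<Sum>i=M..<n. f i)"
      using that by (simp add: sum_diff_nat_ivl lessThan_atLeast0)
    thus ?thesis
      unfolding dist_eq_absval using assms by (auto intro!: absval_sum_le)
  qed
  ultimately show ?thesis
    unfolding dist_eq_absval[symmetric] by (intro LIMSEQ_le_const2) auto
qed

text \<open>A difference of partial sums is no larger than its largest term, so vanishing terms
  already make the partial sums Cauchy.\<close>

lemma summable_ultrametric:
  fixes f :: "nat \<Rightarrow> 'a::complete_ultrametric_field"
  assumes "f \<longlonglongrightarrow> 0"
  shows "summable f"
proof -
  have "Cauchy (\<lambda>n. \<Sum>i<n. f i)"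
  proof (rule metric_CauchyI)
    fix e :: real assume e: "e > 0"
    \<comment> \<open>Half of \<open>e\<close>, because the bound for sums is a non-strict
      inequality.\<close>
    then obtain M where M: "\<And>n. n \<ge> M \<Longrightarrow> absval (f n) < e / 2"
      using metric_LIMSEQ_D[OF assms, of "e / 2"] unfolding absval_def by auto
    have *: "dist (\<Sum>i<m. f i) (\<Sum>i<n. f i) < e" if "m \<ge> n" "n \<ge> M" for m n
    proof -
      have "(\<Sum>i<m. f i) - (\<Sum>i<n. f i) = (\<Sum>i=n..<m. f i)"
        using that by (simp add: sum_diff_nat_ivl lessThan_atLeast0)
      moreover have "absval (\<Sum>i=n..<m. f i) \<le> e / 2"
        using M that e by (intro absval_sum_le) (auto intro: less_imp_le)
      ultimately show ?thesis
        unfolding dist_eq_absval using e by simp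
    qed
    have "dist (\<Sum>i<m. f i) (\<Sum>i<n. f i) < e" if "m \<ge> M" "n \<ge> M" for m n
    proof (cases "m \<ge> n")
      case False
      thus ?thesis using *[of m n] that by (simp add: dist_commute)
    qed (use *[of n m] that in simp)
    thus "\<exists>M. \<forall>m\<ge>M. \<forall>n\<ge>M. dist (\<Sum>i<m. f i) (\<Sum>i<n. f i) < e"
      by blast
  qed
  thus ?thesis
    by (simp add: summable_iff_convergent Cauchy_convergent)
qed

lemma geometric_tendsto_0:
  fixes C \<theta> :: real
  assumes "0 \<le> \<theta>" "\<theta> < 1"
  shows "(\<lambda>n. C * \<theta> ^ n) \<longlonglongrightarrow> 0"
  using tendsto_mult[OF tendsto_const LIMSEQ_realpow_zero[OF assms], of C] by simp

lemma tendsto_geometric_bound: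
  fixes f :: "nat \<Rightarrow> 'a::complete_ultrametric_field"
  assumes "\<And>n. absval (f n - a) \<le> C * \<theta> ^ n" "0 \<le> \<theta>" "\<theta> < 1"
  shows "f \<longlonglongrightarrow> a"
  unfolding tendsto_absval_iff
  by (rule tendsto_sandwich[OF _ _ tendsto_const geometric_tendsto_0[OF assms(2,3), of C]])
    (simp_all add: assms(1))

lemma summable_geometric_bound:
  fixes f :: "nat \<Rightarrow> 'a::complete_ultrametric_field"
  assumes "\<And>n. absval (f n) \<le> C * \<theta> ^ n" "0 \<le> \<theta>" "\<theta> < 1"
  shows "summable f"
  by (rule summable_ultrametric, rule tendsto_geometric_bound[OF _ assms(2,3), where C = C])
    (simp add: assms(1))

lemma absval_suminf_diff_geometric_le:
  fixes f :: "nat \<Rightarrow> 'a::complete_ultrametric_field"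
  assumes f: "\<And>n. absval (f n) \<le> C * \<theta> ^ n" and \<theta>: "0 \<le> \<theta>" "\<theta> < 1"
  shows "absval (suminf f - (\<Sum>n<M. f n)) \<le> C * \<theta> ^ M"
proof (rule absval_suminf_diff_le)
  have C: "C \<ge> 0"
    using order_trans[OF absval_nonneg f[of 0]] by simp
  thus "0 \<le> C * \<theta> ^ M" using \<theta> by simp
  fix n assume "n \<ge> M"
  hence "C * \<theta> ^ n \<le> C * \<theta> ^ M"
    using C \<theta> by (intro mult_left_mono power_decreasing) auto
  with f[of n] show "absval (f n) \<le> C * \<theta> ^ M" by simp
qed (rule summable_geometric_bound[OF assms])

text \<open>Serves to prove identities between infinite sums by truncation at each \<open>M\<close>;
  the threshold \<open>M0\<close> lets short truncations be skipped.\<close>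

lemma eq_if_absval_diff_le_geometric:
  fixes s t :: "'a::complete_ultrametric_field"
  assumes "\<And>M::nat. M \<ge> M0 \<Longrightarrow> absval (s - t) \<le> C * \<theta> ^ M" "0 \<le> \<theta>" "\<theta> < 1"
  shows "s = t"
proof -
  have "absval (s - t) \<le> 0"
    using geometric_tendsto_0[OF assms(2,3), of C]
    by (rule LIMSEQ_le_const) (intro exI[of _ M0] allI impI assms(1))
  thus ?thesis by simp
qed

text \<open>The product of the partial sums and the partial Cauchy sum differ by the terms of the
  square with i + j \<ge> M, all at most C D \<theta>^M. The second claim keeps the product under a
  bound of the same kind, so that it can be multiplied again.\<close>

lemma suminf_mult_geometric_bound:
  fixes a b :: "nat \<Rightarrow> 'a::complete_ultrametric_field"
  assumes a: "\<And>n. absval (a n) \<le> C * \<theta> ^ n" and b: "\<And>n. absval (b n) \<le> D * \<theta> ^ n"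
    and \<theta>: "0 \<le> \<theta>" "\<theta> < 1"
  shows "suminf a * suminf b = (\<Sum>n. \<Sum>i\<le>n. a i * b (n - i))"
    and "absval (\<Sum>i\<le>n. a i * b (n - i)) \<le> C * D * \<theta> ^ n"
proof -
  have C: "C \<ge> 0" using order_trans[OF absval_nonneg a[of 0]] by simp
  have D: "D \<ge> 0" using order_trans[OF absval_nonneg b[of 0]] by simp
  have ab: "absval (a i * b j) \<le> C * D * \<theta> ^ (i + j)" for i j
    unfolding absval_mult
    using mult_mono[OF a[of i] b[of j]] C D \<theta> by (simp add: power_add algebra_simps)
  show conv: "absval (\<Sum>i\<le>n. a i * b (n - i)) \<le> C * D * \<theta> ^ n" for n
  proof (rule absval_sum_le)
    fix i assume "i \<in> {..n}"
    thus "absval (a i * b (n - i)) \<le> C * D * \<theta> ^ n"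
      using ab[of i "n - i"] by simp
  qed (use C D \<theta> in simp)
  let ?c = "\<lambda>n. \<Sum>i\<le>n. a i * b (n - i)"
  show "suminf a * suminf b = suminf ?c"
  proof (rule eq_if_absval_diff_le_geometric[OF _ \<theta>])
    fix M :: nat
    have sa: "absval (suminf a) \<le> C"
      using absval_suminf_diff_geometric_le[OF a \<theta>, of 0] by simp
    have sbM: "absval (\<Sum>n<M. b n) \<le> D"
    proof (rule absval_sum_le)
      fix i
      have "D * \<theta> ^ i \<le> D * 1" using D \<theta> by (intro mult_left_mono power_le_one) auto
      with b[of i] show "absval (b i) \<le> D" by simp
    qed (use D in simp)
    have 1: "absval ((suminf a - (\<Sum>n<M. a n)) * (\<Sum>n<M. b n)) \<le> C * D * \<theta> ^ M"
      unfolding absval_mult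
      using mult_mono[OF absval_suminf_diff_geometric_le[OF a \<theta>, of M] sbM] C D \<theta>
      by (simp add: algebra_simps)
    have 2: "absval (suminf a * (suminf b - (\<Sum>n<M. b n))) \<le> C * D * \<theta> ^ M"
      unfolding absval_mult
      using mult_mono[OF sa absval_suminf_diff_geometric_le[OF b \<theta>, of M]] C D \<theta>
      by (simp add: algebra_simps)
    have "(\<Sum>n<M. a n) * (\<Sum>n<M. b n) = (\<Sum>(i,j)\<in>{..<M}\<times>{..<M}. a i * b j)"
      by (simp add: sum_product sum.cartesian_product)
    moreover have "(\<Sum>n<M. ?c n) = (\<Sum>(i,j)\<in>{(i,j). i + j < M}. a i * b j)"
      by (rule sum.triangle_reindex[symmetric])
    moreover have "{(i,j). i + j < M} \<subseteq> {..<M}\<times>{..<M}" by auto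
    ultimately have "(\<Sum>n<M. a n) * (\<Sum>n<M. b n) - (\<Sum>n<M. ?c n)
        = (\<Sum>(i,j)\<in>{..<M}\<times>{..<M} - {(i,j). i + j < M}. a i * b j)"
      by (simp add: sum_diff)
    moreover have "absval \<dots> \<le> C * D * \<theta> ^ M"
    proof (rule absval_sum_le)
      fix z assume z: "z \<in> {..<M}\<times>{..<M} - {(i,j). i + j < M}"
      obtain i j where ij: "z = (i, j)" by force
      have "C * D * \<theta> ^ (i + j) \<le> C * D * \<theta> ^ M"
        using C D \<theta> z ij by (intro mult_left_mono power_decreasing) auto
      with ab[of i j] ij show "absval (case z of (i, j) \<Rightarrow> a i * b j) \<le> C * D * \<theta> ^ M" by simp
    qed (use C D \<theta> in simp)
    ultimately have 3: "absval ((\<Sum>n<M. a n) * (\<Sum>n<M. b n) - (\<Sum>n<M. ?c n)) \<le> C * D * \<theta> ^ M"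
      by simp
    have 4: "absval (suminf ?c - (\<Sum>n<M. ?c n)) \<le> C * D * \<theta> ^ M"
      by (rule absval_suminf_diff_geometric_le[OF conv \<theta>])
    \<comment> \<open>Four errors: the tails of the two factors, the corner of the square beyond the
      triangle, and the tail of the Cauchy series.\<close>
    have "suminf a * suminf b - suminf ?c =
        ((suminf a - (\<Sum>n<M. a n)) * (\<Sum>n<M. b n) + suminf a * (suminf b - (\<Sum>n<M. b n)))
        + (((\<Sum>n<M. a n) * (\<Sum>n<M. b n) - (\<Sum>n<M. ?c n)) - (suminf ?c - (\<Sum>n<M. ?c n)))"
      by (simp add: algebra_simps)
    also have "absval \<dots> \<le> C * D * \<theta> ^ M"
      by (intro absval_add_leI absval_diff_leI 1 2 3 4)
    finally show "absval (suminf a * suminf b - suminf ?c) \<le> C * D * \<theta> ^ M" .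
  qed
qed

section \<open>The p-adic exponential and logarithm\<close>

text \<open>The radius of convergence of the p-adic exponential, the positive number r with r^(p -
  1) = |p|. Its powers absorb the denominators k! and k.\<close>

definition exp_radius :: "nat \<Rightarrow> real" where
  "exp_radius p = real p powr (- 1 / (real p - 1))"

context padic_complex_field
begin

section \<open>Absolute values of integers and factorials\<close>

lemma exp_radius_pos: "0 < exp_radius p"
  using prime_p prime_gt_0_nat by (simp add: exp_radius_def)

lemma exp_radius_less_1: "exp_radius p < 1"
  using prime_gt_1_nat[OF prime_p] by (simp add: exp_radius_def powr_less_one)

lemma exp_radius_power: "exp_radius p ^ (p - 1) = 1 / real p"
proof -
  have "p > 1" using prime_gt_1_nat[OF prime_p] .
  hence "exp_radius p ^ (p - 1) = real p powr (- 1 / (real p - 1) * real (p - 1))"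
    by (simp add: exp_radius_def powr_realpow[symmetric] powr_powr)
  also have "\<dots> = real p powr (- 1)"
    using \<open>p > 1\<close> by (simp add: of_nat_diff)
  finally show ?thesis
    using \<open>p > 1\<close> by (simp add: powr_minus divide_inverse)
qed

text \<open>By Bezout some multiple v k is 1 minus a multiple of p, hence has absolute value 1; as
  neither factor exceeds 1, both equal 1.\<close>

lemma absval_of_nat_eq_1:
  assumes "\<not> p dvd k"
  shows "absval (of_nat k :: 'a) = 1"
proof -
  have "coprime (int p) (int k)"
    using assms prime_p by (simp add: prime_imp_coprime)
  then obtain u v where uv: "u * int p + v * int k = 1"
    using bezout_int[of "int p" "int k"] by auto
  have "absval (of_int u * of_nat p :: 'a) \<le> 1 / real p"
    unfolding absval_mult absval_p using absval_of_int_le_1[of u, where ?'a = 'a]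
    by (simp add: divide_right_mono)
  also have "\<dots> < 1" using prime_gt_1_nat[OF prime_p] by simp
  finally have small: "absval (of_int u * of_nat p :: 'a) < 1" .
  have eq: "of_int v * of_nat k = 1 - (of_int u * of_nat p :: 'a)"
    using arg_cong[OF uv, of "of_int :: int \<Rightarrow> 'a"] by (simp add: algebra_simps)
  have "absval (of_int v :: 'a) * absval (of_nat k :: 'a) = 1"
    unfolding absval_mult[symmetric] eq
    using absval_add_eq[of "- (of_int u * of_nat p)" "1::'a"] small by simp
  moreover have "absval (of_int v :: 'a) * absval (of_nat k :: 'a) \<le> 1 * absval (of_nat k :: 'a)"
    by (intro mult_right_mono absval_of_int_le_1) simp
  ultimately show ?thesis
    using absval_of_nat_le_1[of k, where ?'a = 'a] by linarith
qed

text \<open>Only the multiples of p among 1, ..., k count; there are k div p of them, and dividing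
  each by p leaves (k div p)!.\<close>

lemma absval_fact: "absval (fact k :: 'a) = (1 / real p) ^ (k div p) * absval (fact (k div p) :: 'a)"
proof (induction k)
  case (Suc k)
  have IH: "absval (fact (Suc k) :: 'a)
      = absval (of_nat (Suc k) :: 'a) * ((1 / real p) ^ (k div p) * absval (fact (k div p) :: 'a))"
    unfolding fact_Suc of_nat_mult absval_mult Suc.IH by simp
  show ?case
  proof (cases "p dvd Suc k")
    case False
    hence "Suc k div p = k div p" by (simp add: div_Suc mod_eq_0_iff_dvd)
    thus ?thesis using IH absval_of_nat_eq_1[OF False] by simp
  next
    case True
    hence div: "Suc k div p = Suc (k div p)" by (simp add: div_Suc mod_eq_0_iff_dvd)
    have "Suc k = p * Suc (k div p)" using True div by (metis dvd_mult_div_cancel)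
    hence "absval (of_nat (Suc k) :: 'a) = 1 / real p * absval (of_nat (Suc (k div p)) :: 'a)"
      by (metis absval_mult absval_p of_nat_mult)
    moreover have "absval (fact (Suc (k div p)) :: 'a)
        = absval (of_nat (Suc (k div p)) :: 'a) * absval (fact (k div p) :: 'a)"
      by (simp only: fact_Suc absval_mult)
    ultimately show ?thesis unfolding IH div by simp
  qed
qed simp

text \<open>Legendre's recursion from k to k div p, with r^(p - 1) in place of |p|. The exponent k -
  1 rather than k leaves a spare factor |z| in the terms z^k / k!.\<close>

lemma absval_fact_ge: "k \<ge> 1 \<Longrightarrow> absval (fact k :: 'a) \<ge> exp_radius p ^ (k - 1)"
proof (induction k rule: less_induct)
  case (less k)
  let ?r = "exp_radius p" and ?m = "k div p"
  have p: "p > 1" using prime_gt_1_nat[OF prime_p] .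
  note r = exp_radius_pos exp_radius_less_1
  show ?case
  proof (cases "?m = 0")
    case True
    thus ?thesis
      using r absval_fact[of k] by (simp add: power_le_one)
  next
    case False
    hence "?r ^ (?m - 1) \<le> absval (fact ?m :: 'a)"
      using p less.prems by (intro less.IH) auto
    moreover have "?r ^ (k - 1) \<le> (1 / real p) ^ ?m * ?r ^ (?m - 1)"
    proof -
      \<comment> \<open>Exponent count with m = k div p: each of the m factors 1/p costs p - 1
        powers of r, and m! costs m - 1 more.\<close>
      have "(p - 1) * ?m + (?m - 1) = p * ?m - 1"
        using False p by (simp add: diff_mult_distrib)
      also have "\<dots> \<le> k - 1"
        by (intro diff_le_mono) simp
      finally have "(p - 1) * ?m + (?m - 1) \<le> k - 1" .
      hence "?r ^ (k - 1) \<le> ?r ^ ((p - 1) * ?m + (?m - 1))"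
        using r by (intro power_decreasing) auto
      thus ?thesis by (simp only: power_add power_mult exp_radius_power)
    qed
    ultimately show ?thesis
      unfolding absval_fact[of k]
      by (smt (verit) mult_left_mono of_nat_0_le_iff zero_le_divide_1_iff zero_le_power)
  qed
qed

text \<open>k divides k! with a cofactor of absolute value at most 1, so the bound for k! passes to
  k.\<close>

lemma absval_of_nat_ge: "k \<ge> 1 \<Longrightarrow> absval (of_nat k :: 'a) \<ge> exp_radius p ^ (k - 1)"
proof -
  assume k: "k \<ge> 1"
  hence "fact k = (of_nat k * fact (k - 1) :: 'a)"
    by (simp add: fact_reduce)
  hence "absval (fact k :: 'a) \<le> absval (of_nat k :: 'a) * absval (of_nat (fact (k - 1)) :: 'a)"
    by (simp add: absval_mult)
  also have "\<dots> \<le> absval (of_nat k :: 'a) * 1"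
    by (intro mult_left_mono absval_of_nat_le_1) simp
  finally show ?thesis using absval_fact_ge[OF k] by simp
qed

text \<open>One estimate for both series, with c = k! for the exponential and c = k for the
  logarithm. The separate factor |z| permits comparison with the linear term.\<close>

lemma absval_power_div_le:
  assumes "k \<ge> 1" "exp_radius p ^ (k - 1) \<le> absval (c :: 'a)"
  shows "absval (z ^ k / c) \<le> absval z * (absval z / exp_radius p) ^ (k - 1)"
proof -
  let ?r = "exp_radius p"
  have r: "?r ^ (k - 1) > 0" using exp_radius_pos by simp
  have "absval (z ^ k / c) = absval z ^ k / absval c"
    by (simp add: absval_divide absval_power)
  also have "\<dots> \<le> absval z ^ k / ?r ^ (k - 1)"
    using r assms by (intro divide_left_mono) (auto intro: mult_pos_pos)
  also have "absval z ^ k = absval z * absval z ^ (k - 1)"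
    using assms(1) by (metis Suc_diff_1 less_le_trans power_Suc zero_less_one)
  finally show ?thesis by (simp add: power_divide)
qed

lemma absval_power_div_le':
  assumes "k \<ge> 1" "exp_radius p ^ (k - 1) \<le> absval (c :: 'a)"
  shows "absval (z ^ k / c) \<le> exp_radius p * (absval z / exp_radius p) ^ k"
proof -
  have "(absval z / exp_radius p) ^ k
      = (absval z / exp_radius p) * (absval z / exp_radius p) ^ (k - 1)"
    using assms(1) by (metis Suc_diff_1 less_le_trans power_Suc zero_less_one)
  thus ?thesis
    using absval_power_div_le[OF assms, of z] exp_radius_pos by simp
qed

section \<open>The exponential on its disc of convergence\<close>

text \<open>\<theta> is a parameter so that one ratio can serve two arguments in a Cauchy
  product.\<close>

lemma absval_exp_term_le:
  assumes "absval (z :: 'a) \<le> \<theta> * exp_radius p"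
  shows "absval (z ^ k / fact k) \<le> 1 * \<theta> ^ k"
proof (cases "k = 0")
  case False
  have "absval (z ^ k / fact k) \<le> exp_radius p * (absval z / exp_radius p) ^ k"
    using False by (intro absval_power_div_le' absval_fact_ge) auto
  also have "\<dots> \<le> 1 * \<theta> ^ k"
    using assms exp_radius_pos exp_radius_less_1
    by (intro mult_mono power_mono) (auto simp: field_simps)
  finally show ?thesis .
qed simp

text \<open>Cauchy product of the two series, with the larger ratio for both; the binomial theorem
  identifies its terms.\<close>

lemma padic_exp_add:
  assumes "absval (z :: 'a) < exp_radius p" "absval w < exp_radius p"
  shows "padic_exp (z + w) = padic_exp z * padic_exp w"
proof -
  let ?\<theta> = "max (absval z) (absval w) / exp_radius p"
  have \<theta>: "0 \<le> ?\<theta>" "?\<theta> < 1"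
    using assms exp_radius_pos by (auto simp: le_max_iff_disj)
  have "absval z \<le> ?\<theta> * exp_radius p" "absval w \<le> ?\<theta> * exp_radius p"
    using exp_radius_pos by auto
  note bounds = this[THEN absval_exp_term_le]
  have "padic_exp z * padic_exp w
      = (\<Sum>n. \<Sum>i\<le>n. z ^ i / fact i * (w ^ (n - i) / fact (n - i)))"
    unfolding padic_exp_def using suminf_mult_geometric_bound(1)[OF bounds \<theta>] .
  also have "(\<lambda>n. \<Sum>i\<le>n. z ^ i / fact i * (w ^ (n - i) / fact (n - i)))
      = (\<lambda>n. (z + w) ^ n / fact n)"
  proof
    fix n
    have "(z + w) ^ n / fact n = (\<Sum>i\<le>n. of_nat (n choose i) * z ^ i * w ^ (n - i) / fact n)"
      by (simp add: binomial_ring sum_divide_distrib)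
    also have "\<dots> = (\<Sum>i\<le>n. z ^ i / fact i * (w ^ (n - i) / fact (n - i)))"
      by (intro sum.cong refl) (simp add: binomial_fact)
    finally show "(\<Sum>i\<le>n. z ^ i / fact i * (w ^ (n - i) / fact (n - i))) = (z + w) ^ n / fact n"
      by simp
  qed
  finally show ?thesis unfolding padic_exp_def by simp
qed

text \<open>Every term from the quadratic one on carries at least one factor |z| / r beyond
  |z|.\<close>

lemma absval_exp_minus_le:
  assumes z: "absval (z :: 'a) < exp_radius p"
  shows "absval (padic_exp z - 1 - z) \<le> absval z * (absval z / exp_radius p)"
proof -
  let ?\<theta> = "absval z / exp_radius p"
  have \<theta>: "0 \<le> ?\<theta>" "?\<theta> < 1"
    using z exp_radius_pos by auto
  have le: "absval (z ^ k / fact k) \<le> absval z * ?\<theta>" if "k \<ge> 2" for k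
  proof -
    have "absval (z ^ k / fact k) \<le> absval z * ?\<theta> ^ (k - 1)"
      using that by (intro absval_power_div_le absval_fact_ge) auto
    also have "\<dots> \<le> absval z * ?\<theta> ^ 1"
      using that \<theta> by (intro mult_left_mono power_decreasing) auto
    finally show ?thesis by simp
  qed
  have "summable (\<lambda>k. z ^ k / fact k)"
    by (rule summable_geometric_bound[OF absval_exp_term_le \<theta>]) (use exp_radius_pos in simp)
  hence "absval (padic_exp z - (\<Sum>k<2. z ^ k / fact k)) \<le> absval z * ?\<theta>"
    unfolding padic_exp_def using \<theta> by (intro absval_suminf_diff_le[OF _ le] mult_nonneg_nonneg) auto
  thus ?thesis by (simp add: numeral_2_eq_2 diff_diff_eq)
qed

text \<open>The linear term dominates, because |z| / r < 1 makes the remainder strictly smaller than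
  |z|. Injectivity and the estimates for q-powers rest on this isometry.\<close>

lemma absval_exp_minus_1:
  assumes z: "absval (z :: 'a) < exp_radius p"
  shows "absval (padic_exp z - 1) = absval z"
proof (cases "z = 0")
  case True
  thus ?thesis using absval_exp_minus_le[OF z] by simp
next
  case False
  hence "absval z * (absval z / exp_radius p) < absval z * 1"
    using z exp_radius_pos by (intro mult_strict_left_mono) (auto simp: less_le)
  hence "absval (padic_exp z - 1 - z) < absval z"
    using absval_exp_minus_le[OF z] by simp
  from absval_add_eq[OF this] show ?thesis by simp
qed

lemma padic_exp_0 [simp]: "padic_exp (0 :: 'a) = 1"
  using absval_exp_minus_1[of 0] exp_radius_pos by simp

lemma padic_exp_minus:
  assumes "absval (z :: 'a) < exp_radius p"
  shows "padic_exp z * padic_exp (- z) = 1"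
  using padic_exp_add[of z "- z"] assms by simp

lemma absval_padic_exp:
  assumes z: "absval (z :: 'a) < exp_radius p"
  shows "absval (padic_exp z) = 1"
  using absval_add_eq[of "padic_exp z - 1" 1] absval_exp_minus_1[OF z] z exp_radius_less_1 by simp

lemma absval_of_nat_mult_le: "absval (of_nat m * z) \<le> absval (z :: 'a)"
  using mult_right_mono[OF absval_of_nat_le_1[of m, where ?'a = 'a], of "absval z"]
  by (simp add: absval_mult)

lemma padic_exp_of_nat_mult:
  assumes z: "absval (z :: 'a) < exp_radius p"
  shows "padic_exp (of_nat m * z) = padic_exp z ^ m"
proof (induction m)
  case (Suc m)
  have "padic_exp (of_nat (Suc m) * z) = padic_exp (z + of_nat m * z)"
    by (simp add: algebra_simps)
  also have "\<dots> = padic_exp z * padic_exp (of_nat m * z)"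
    using z absval_of_nat_mult_le[of m z] by (intro padic_exp_add) auto
  finally show ?case using Suc by simp
qed simp

text \<open>exp (z - w) = 1, while |exp (z - w) - 1| = |z - w|.\<close>

lemma padic_exp_inj:
  assumes z: "absval (z :: 'a) < exp_radius p" and w: "absval w < exp_radius p"
    and eq: "padic_exp z = padic_exp w"
  shows "z = w"
proof -
  have zw: "absval (z - w) < exp_radius p"
    using absval_add_le[of z "- w"] z w by auto
  have "padic_exp (z - w) = padic_exp z * padic_exp (- w)"
    using padic_exp_add[of z "- w"] z w by simp
  also have "\<dots> = 1" using eq padic_exp_minus[OF w] by simp
  finally show ?thesis using absval_exp_minus_1[OF zw] by simp
qed

section \<open>The logarithm as inverse of the exponential\<close>

text \<open>Iterated Cauchy products carry formal powers of the logarithm over to values at u, so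
  that formal identities can be evaluated there. The factor r^k is kept to pay for a later division
  by k!.\<close>

lemma fps_ln_power_term_bound:
  fixes u :: 'a
  assumes u: "absval u < exp_radius p"
  defines "\<theta> \<equiv> absval u / exp_radius p"
  shows "(\<Sum>n. (fps_ln 1 ^ k) $ n * u ^ n) = padic_log (1 + u) ^ k"
    and "absval ((fps_ln 1 ^ k) $ n * u ^ n) \<le> exp_radius p ^ k * \<theta> ^ n"
proof -
  let ?r = "exp_radius p" and ?L = "fps_ln 1 :: 'a fps"
  have \<theta>: "0 \<le> \<theta>" "\<theta> < 1"
    using u exp_radius_pos by (auto simp: \<theta>_def)
  have L: "absval (?L $ n * u ^ n) \<le> ?r * \<theta> ^ n" for n
  proof (cases "n = 0")
    case False
    have "absval (?L $ n * u ^ n) = absval (u ^ n / of_nat n)"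
      using False by (simp add: fps_ln_nth absval_mult absval_divide)
    also have "\<dots> \<le> ?r * \<theta> ^ n"
      unfolding \<theta>_def using False by (intro absval_power_div_le' absval_of_nat_ge) auto
    finally show ?thesis .
  qed (use exp_radius_pos in simp)
  have log: "(\<Sum>n. ?L $ n * u ^ n) = padic_log (1 + u)"
  proof -
    have "summable (\<lambda>n. ?L $ n * u ^ n)"
      by (rule summable_geometric_bound[OF L \<theta>])
    \<comment> \<open>The constant coefficient of \<open>fps_ln 1\<close> is 0; splitting it off
      aligns the series with \<open>padic_log\<close>, which starts at the first power.\<close>
    hence "(\<lambda>n. \<Sum>i<Suc n. ?L $ i * u ^ i) \<longlonglongrightarrow> (\<Sum>n. ?L $ n * u ^ n)"
      by (intro filterlim_compose[OF _ filterlim_Suc]) (rule summable_LIMSEQ)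
    hence "(\<lambda>n. ?L $ Suc n * u ^ Suc n) sums (\<Sum>n. ?L $ n * u ^ n)"
      unfolding sums_def by (subst (asm) sum.lessThan_Suc_shift) simp
    thus ?thesis
      by (simp add: padic_log_def fps_ln_nth sums_iff)
  qed
  \<comment> \<open>One induction for both claims: the Cauchy product for the next power needs the
    bound as well as the sum.\<close>
  have "(\<forall>n. absval ((?L ^ k) $ n * u ^ n) \<le> ?r ^ k * \<theta> ^ n)
      \<and> (\<Sum>n. (?L ^ k) $ n * u ^ n) = padic_log (1 + u) ^ k"
  proof (induction k)
    case 0
    have "(\<lambda>n. (?L ^ 0) $ n * u ^ n) = (\<lambda>n. if n = 0 then 1 else 0)" by auto
    moreover have "(\<lambda>n::nat. if n = 0 then 1 else 0 :: 'a) sums 1"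
      by (rule sums_single[of 0 "\<lambda>_. 1"])
    ultimately show ?case using \<theta> by (simp add: sums_iff)
  next
    case (Suc k)
    have "(?L ^ Suc k) $ n * u ^ n
        = (\<Sum>i\<le>n. (?L $ i * u ^ i) * ((?L ^ k) $ (n - i) * u ^ (n - i)))" for n
    proof -
      have "(?L ^ Suc k) $ n * u ^ n = (\<Sum>i\<le>n. ?L $ i * (?L ^ k) $ (n - i) * u ^ n)"
        by (simp add: fps_mult_nth atLeast0AtMost sum_distrib_right)
      also have "\<dots> = (\<Sum>i\<le>n. (?L $ i * u ^ i) * ((?L ^ k) $ (n - i) * u ^ (n - i)))"
      proof (intro sum.cong refl)
        fix i assume "i \<in> {..n}"
        hence "u ^ n = u ^ i * u ^ (n - i)" by (simp add: power_add[symmetric])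
        thus "?L $ i * (?L ^ k) $ (n - i) * u ^ n
            = (?L $ i * u ^ i) * ((?L ^ k) $ (n - i) * u ^ (n - i))" by simp
      qed
      finally show ?thesis .
    qed
    thus ?case
      using suminf_mult_geometric_bound[OF L conjunct1[OF Suc.IH, rule_format] \<theta>] Suc.IH log
      by simp
  qed
  thus "(\<Sum>n. (?L ^ k) $ n * u ^ n) = padic_log (1 + u) ^ k"
    and "absval ((?L ^ k) $ n * u ^ n) \<le> ?r ^ k * \<theta> ^ n" by blast+
qed

text \<open>The linear term has the size of 1 - q and no other term is larger. Hence log q lies in
  the disc where the exponential converges.\<close>

lemma absval_padic_log_le:
  assumes q: "absval (1 - q :: 'a) < exp_radius p"
  shows "absval (padic_log q) \<le> absval (1 - q)"
proof -
  let ?\<theta> = "absval (1 - q) / exp_radius p"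
  have \<theta>: "0 \<le> ?\<theta>" "?\<theta> < 1"
    using q exp_radius_pos by auto
  have "absval ((- 1) ^ k * (q - 1) ^ Suc k / of_nat (Suc k)) \<le> absval (1 - q) * ?\<theta> ^ k" for k
  proof -
    have "absval ((- 1) ^ k * (q - 1) ^ Suc k / of_nat (Suc k))
        = absval ((q - 1) ^ Suc k / of_nat (Suc k))"
      by (simp only: absval_mult absval_divide absval_power_minus1 mult_1)
    also have "\<dots> \<le> absval (q - 1) * (absval (q - 1) / exp_radius p) ^ (Suc k - 1)"
      by (intro absval_power_div_le absval_of_nat_ge) auto
    finally show ?thesis by (simp add: absval_minus_commute)
  qed
  from absval_suminf_diff_geometric_le[OF this \<theta>, of 0]
  show ?thesis by (simp add: padic_log_def)
qed

lemma fps_exp_compose_ln: "(fps_exp 1 - 1) oo fps_ln (1 :: 'b::field_char_0) = fps_X"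
  using fps_ln_fps_exp_inv[of "1::'b"] fps_inv_right[of "fps_exp 1 - 1 :: 'b fps"] by simp

text \<open>
  The double series for \<open>exp (log (1 + u))\<close> is cut off at \<open>M\<close> in both indices. Summed over the
  exponential index first, the square is exactly \<open>1 + u\<close>, by the identity of formal power series;
  what is cut off is at most \<open>\<theta> ^ M\<close>, because the denominators \<open>k!\<close> and \<open>j\<close> are absorbed by
  powers of the radius.
\<close>

lemma padic_exp_log:
  assumes q: "absval (1 - q :: 'a) < exp_radius p"
  shows "padic_exp (padic_log q) = q"
proof -
  define u where "u = q - 1"
  have u: "absval u < exp_radius p" and q_eq: "q = 1 + u"
    using q by (simp_all add: u_def absval_minus_commute)
  let ?r = "exp_radius p" and ?\<theta> = "absval u / exp_radius p"
    and ?L = "fps_ln 1 :: 'a fps" and ?l = "padic_log q"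
  have \<theta>: "0 \<le> ?\<theta>" "?\<theta> < 1"
    using u exp_radius_pos by auto
  have l: "absval ?l \<le> ?\<theta> * ?r"
    using absval_padic_log_le[OF q] exp_radius_pos by (simp add: u_def absval_minus_commute)
  have fact_le: "absval (c / fact k) \<le> x" if c: "absval c \<le> ?r ^ k * x" and x: "x \<ge> 0"
    for c :: 'a and k x
  proof -
    have "?r ^ k \<le> absval (fact k :: 'a)"
    proof (cases "k = 0")
      case False
      have "?r ^ k \<le> ?r ^ (k - 1)"
        using exp_radius_pos exp_radius_less_1 by (intro power_decreasing) auto
      also have "\<dots> \<le> absval (fact k :: 'a)" using False by (intro absval_fact_ge) auto
      finally show ?thesis .
    qed simp
    hence "absval c \<le> absval (fact k :: 'a) * x"
      using c x by (meson mult_right_mono order_trans)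
    thus ?thesis by (simp add: absval_divide divide_le_eq mult.commute less_le)
  qed
  show ?thesis
  \<comment> \<open>From M = 2 on the truncation contains both terms of 1 + u.\<close>
  proof (rule eq_if_absval_diff_le_geometric[OF _ \<theta>, of 2 _ _ 1])
    fix M :: nat assume M: "M \<ge> 2"
    have "(\<Sum>n<M. \<Sum>k<M. (?L ^ k) $ n * u ^ n / fact k)
        = (\<Sum>n<M. (1 + fps_X :: 'a fps) $ n * u ^ n)"
    proof (intro sum.cong refl)
      fix n assume n: "n \<in> {..<M}"
      \<comment> \<open>\<open>fps_ln 1\<close> has no constant term, so its k-th power has no terms
        below degree k: for n < M the cutoff of k at M loses nothing.\<close>
      have "(\<Sum>k<M. (?L ^ k) $ n * u ^ n / fact k) = (\<Sum>k\<in>{0..n}. (?L ^ k) $ n * u ^ n / fact k)"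
        using n startsby_zero_power_prefix[of ?L]
        by (intro sum.mono_neutral_right) (auto simp: not_le)
      also have "\<dots> = (fps_exp 1 oo ?L) $ n * u ^ n"
        by (simp add: fps_compose_nth sum_distrib_right)
      also have "fps_exp 1 oo ?L = 1 + fps_X"
        using fps_exp_compose_ln[where ?'b = 'a]
        by (simp add: fps_compose_sub_distrib algebra_simps)
      finally show "(\<Sum>k<M. (?L ^ k) $ n * u ^ n / fact k) = (1 + fps_X :: 'a fps) $ n * u ^ n" .
    qed
    also have "\<dots> = (\<Sum>n<2. (1 + fps_X :: 'a fps) $ n * u ^ n)"
      using M by (intro sum.mono_neutral_right) auto
    also have "\<dots> = q" by (simp add: q_eq numeral_2_eq_2)
    finally have q_sum: "(\<Sum>k<M. (\<Sum>n<M. (?L ^ k) $ n * u ^ n) / fact k) = q"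
      by (subst (asm) sum.swap) (simp add: sum_divide_distrib)
    have "absval (?l ^ k / fact k - (\<Sum>n<M. (?L ^ k) $ n * u ^ n) / fact k) \<le> ?\<theta> ^ M" for k
    proof -
      have "absval (?l ^ k - (\<Sum>n<M. (?L ^ k) $ n * u ^ n)) \<le> ?r ^ k * ?\<theta> ^ M"
        using absval_suminf_diff_geometric_le[OF fps_ln_power_term_bound(2)[OF u] \<theta>]
        by (simp add: fps_ln_power_term_bound(1)[OF u] q_eq)
      thus ?thesis
        unfolding diff_divide_distrib[symmetric] by (rule fact_le) (use \<theta> in simp)
    qed
    hence "absval ((\<Sum>k<M. ?l ^ k / fact k) - q) \<le> ?\<theta> ^ M"
      unfolding q_sum[symmetric] sum_subtractf[symmetric] using \<theta> by (intro absval_sum_le) auto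
    moreover have "absval (padic_exp ?l - (\<Sum>k<M. ?l ^ k / fact k)) \<le> 1 * ?\<theta> ^ M"
      unfolding padic_exp_def by (rule absval_suminf_diff_geometric_le[OF absval_exp_term_le[OF l] \<theta>])
    ultimately show "absval (padic_exp ?l - q) \<le> 1 * ?\<theta> ^ M"
      using absval_add_leI[of "padic_exp ?l - (\<Sum>k<M. ?l ^ k / fact k)" "?\<theta> ^ M"
          "(\<Sum>k<M. ?l ^ k / fact k) - q"] by simp
  qed
qed

lemma absval_base_eq_1:
  assumes q: "absval (1 - q :: 'a) < exp_radius p"
  shows "absval q = 1"
  using absval_add_eq[of "q - 1" 1] q exp_radius_less_1 absval_minus_commute[of 1 q] by simp

text \<open>1 - q^m is 1 - q times a sum of powers of q, each of absolute value 1. Hence the bases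
  q^\<alpha>, q^\<beta> and q^d stay in the disc.\<close>

lemma absval_1_minus_power_less:
  assumes q: "absval (1 - q :: 'a) < exp_radius p"
  shows "absval (1 - q ^ m) < exp_radius p"
  using absval_power_diff_le[of 1 1 q m] absval_base_eq_1[OF q] q by simp

text \<open>Both sides lie in the disc where the exponential is injective, and both have exponential
  q^m.\<close>

lemma padic_log_power:
  assumes q: "absval (1 - q :: 'a) < exp_radius p"
  shows "padic_log (q ^ m) = of_nat m * padic_log q"
proof (rule padic_exp_inj)
  have l: "absval (padic_log q) < exp_radius p"
    using absval_padic_log_le[OF q] q by simp
  show "absval (of_nat m * padic_log q) < exp_radius p"
    using absval_of_nat_mult_le[of m "padic_log q"] l by simp
  show "absval (padic_log (q ^ m)) < exp_radius p"
    using absval_padic_log_le absval_1_minus_power_less[OF q, of m] by force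
  show "padic_exp (padic_log (q ^ m)) = padic_exp (of_nat m * padic_log q)"
    using padic_exp_of_nat_mult[OF l] padic_exp_log[OF q]
      padic_exp_log[OF absval_1_minus_power_less[OF q]] by simp
qed

text \<open>m log q = 0 forces log q = 0 in characteristic 0, so 1 is the only root of unity in the
  disc. This keeps the case q = 1 of \<open>qnumber\<close> in step for the bases q and q^d.\<close>

lemma power_eq_1_imp:
  assumes q: "absval (1 - q :: 'a) < exp_radius p" and "q ^ m = 1" "m > 0"
  shows "q = 1"
proof -
  have "padic_log (1 :: 'a) = 0"
    using absval_padic_log_le[of 1] exp_radius_pos by simp
  hence "padic_log q = 0"
    using padic_log_power[OF q, of m] assms by simp
  thus ?thesis using padic_exp_log[OF q] by simp
qed

section \<open>Powers and q-numbers\<close>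

lemma absval_mult_padic_log_less:
  assumes q: "absval (1 - q :: 'a) < exp_radius p" and y: "absval y \<le> 1"
  shows "absval (y * padic_log q) < exp_radius p"
proof -
  have "absval (y * padic_log q) \<le> 1 * absval (padic_log q)"
    unfolding absval_mult using y by (intro mult_right_mono) auto
  with absval_padic_log_le[OF q] q show ?thesis by simp
qed

lemma qpow_power_base:
  assumes q: "absval (1 - q :: 'a) < exp_radius p"
  shows "qpow (q ^ m) y = qpow q (of_nat m * y)"
  by (simp add: qpow_def padic_log_power[OF q] mult_ac)

lemma qpow_of_nat:
  assumes q: "absval (1 - q :: 'a) < exp_radius p"
  shows "qpow q (of_nat m) = q ^ m"
  using padic_exp_of_nat_mult[of "padic_log q" m] padic_exp_log[OF q]
    absval_padic_log_le[OF q] q by (simp add: qpow_def)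

lemma qpow_add:
  assumes q: "absval (1 - q :: 'a) < exp_radius p" and "absval y \<le> 1" "absval h \<le> 1"
  shows "qpow q (y + h) = qpow q y * qpow q h"
  using padic_exp_add absval_mult_padic_log_less[OF q] assms
  by (simp add: qpow_def distrib_right)

lemma qpow_minus_of_nat:
  assumes q: "absval (1 - q :: 'a) < exp_radius p"
  shows "qpow q (- of_nat m) * q ^ m = 1"
  using qpow_add[OF q, of "- of_nat m" "of_nat m"] qpow_of_nat[OF q, of m]
  by (simp add: absval_of_nat_le_1 qpow_def)

lemma absval_qpow_minus_1_le:
  assumes q: "absval (1 - q :: 'a) < exp_radius p" and y: "absval y \<le> 1"
  shows "absval (qpow q y - 1) \<le> absval y"
proof -
  have "absval (qpow q y - 1) = absval y * absval (padic_log q)"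
    unfolding qpow_def using absval_exp_minus_1[OF absval_mult_padic_log_less[OF q y]]
    by (simp add: absval_mult)
  also have "\<dots> \<le> absval y * 1"
    using absval_padic_log_le[OF q] q exp_radius_less_1 by (intro mult_left_mono) auto
  finally show ?thesis by simp
qed

text \<open>The factor 1 - q^d cancels between the two q-numbers. \<open>y\<close> ranges over the
  whole field, as x + a/d + t can leave the unit disc when p divides d.\<close>

lemma qnumber_mult:
  assumes q: "absval (1 - q :: 'a) < exp_radius p" and d: "d > 0"
  shows "qnumber q (of_nat d * y) = qnumber q (of_nat d) * qnumber (q ^ d) y"
proof (cases "q = 1")
  case False
  hence "q ^ d \<noteq> 1" using power_eq_1_imp[OF q _ d] by blast
  thus ?thesis
    using False by (simp add: qnumber_def qpow_power_base[OF q] qpow_of_nat[OF q] divide_simps)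
qed (simp add: qnumber_def)

lemma qnumber_of_nat_neq_0:
  assumes q: "absval (1 - q :: 'a) < exp_radius p" and d: "d > 0"
  shows "qnumber q (of_nat d) \<noteq> 0"
  using power_eq_1_imp[OF q _ d] d by (auto simp: qnumber_def qpow_of_nat[OF q])

text \<open>For q other than 1, |q^y| = 1 gives the increment of the q-number the size |q^h - 1| /
  |1 - q|, at most |h| / |1 - q|. Boundedness of q-numbers then handles the k-th power.\<close>

lemma qnumber_power_lipschitz:
  assumes q: "absval (1 - q :: 'a) < exp_radius p"
  obtains C where "C \<ge> 0"
    "\<And>y h. absval y \<le> 1 \<Longrightarrow> absval h \<le> 1 \<Longrightarrow>
      absval (qnumber q (y + h) ^ k - qnumber q y ^ k) \<le> C * absval h"
proof -
  \<comment> \<open>For q = 1 the q-number is the identity, with Lipschitz constant 1. The same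
    \<open>B\<close> bounds the q-numbers themselves, since \<open>qnumber q 0\<close> is 0.\<close>
  define B where "B = (if q = 1 then 1 else 1 / absval (1 - q))"
  have B: "B \<ge> 0" by (simp add: B_def)
  have lip: "absval (qnumber q (y + h) - qnumber q y) \<le> B * absval h"
    if y: "absval y \<le> 1" and h: "absval h \<le> 1" for y h
  proof (cases "q = 1")
    case False
    have "qnumber q (y + h) - qnumber q y = qpow q y * (1 - qpow q h) / (1 - q)"
      unfolding qnumber_def qpow_add[OF q y h] using False
      by (simp add: diff_divide_distrib[symmetric] right_diff_distrib)
    hence "absval (qnumber q (y + h) - qnumber q y) = absval (qpow q h - 1) / absval (1 - q)"
      using absval_padic_exp[OF absval_mult_padic_log_less[OF q y]]
      by (simp add: absval_divide absval_mult qpow_def absval_minus_commute[of 1])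
    also have "\<dots> \<le> absval h / absval (1 - q)"
      by (intro divide_right_mono absval_qpow_minus_1_le[OF q h]) simp
    finally show ?thesis using False by (simp add: B_def)
  qed (simp add: qnumber_def B_def)
  have bound: "absval (qnumber q y) \<le> B" if y: "absval y \<le> 1" for y
  proof -
    have "absval (qnumber q y) \<le> B * absval y"
      using lip[of 0 y] y by (simp add: qnumber_def qpow_def split: if_splits)
    also have "\<dots> \<le> B * 1" using B y by (intro mult_left_mono)
    finally show ?thesis by simp
  qed
  show thesis
  proof (rule that)
    show "B * B ^ (k - 1) \<ge> 0" using B by simp
    fix y h :: 'a assume y: "absval y \<le> 1" and h: "absval h \<le> 1"
    have "absval (qnumber q (y + h) ^ k - qnumber q y ^ k)
        \<le> absval (qnumber q (y + h) - qnumber q y) * B ^ (k - 1)"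
      by (intro absval_power_diff_le bound absval_add_leI y h)
    also have "\<dots> \<le> B * absval h * B ^ (k - 1)"
      using B by (intro mult_right_mono lip y h) simp
    finally show "absval (qnumber q (y + h) ^ k - qnumber q y ^ k) \<le> B * B ^ (k - 1) * absval h"
      by (simp add: mult_ac)
  qed
qed

lemma absval_of_nat_prime_power: "absval (of_nat (p ^ N) :: 'a) = (1 / real p) ^ N"
  by (simp add: absval_power absval_p)

section \<open>Fermionic integrals\<close>

text \<open>Serves two splittings: into blocks of length p^N and, with the factors exchanged, into
  residue classes modulo d.\<close>

lemma sum_lessThan_mult:
  fixes f :: "nat \<Rightarrow> 'b::comm_monoid_add"
  shows "(\<Sum>s<m * k. f s) = (\<Sum>a<m. \<Sum>t<k. f (t + a * k))"
proof -
  have "sum f {a * k..<a * k + k} = (\<Sum>t<k. f (t + a * k))" for a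
    using sum.shift_bounds_nat_ivl[of f 0 "a * k" k]
    by (simp add: lessThan_atLeast0 add.commute)
  thus ?thesis by (simp flip: sum.nat_group)
qed

lemma sum_power_minus1_odd: "odd m \<Longrightarrow> (\<Sum>a<m. (- 1) ^ a) = (1 :: 'b::comm_ring_1)"
proof (elim oddE, clarify)
  fix b show "(\<Sum>a<2 * b + 1. (- 1) ^ a) = (1 :: 'b)"
    by (induction b) simp_all
qed

text \<open>Cut the long sum into m blocks of length p^N. As p^N is odd, block a carries the sign
  (-1)^a; as m is odd, these signs add up to 1, so the short sum can be spread over the blocks and
  compared termwise.\<close>

lemma absval_alternating_sum_diff_le:
  fixes h :: "nat \<Rightarrow> 'a"
  assumes h: "\<And>t s. absval (h (t + s * p ^ N) - h t) \<le> C" and "odd p" "odd m"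
  shows "absval ((\<Sum>s<m * p ^ N. (- 1) ^ s * h s) - (\<Sum>t<p ^ N. (- 1) ^ t * h t)) \<le> C"
proof -
  have C: "0 \<le> C" using h[of 0 0] by simp
  have "(\<Sum>s<m * p ^ N. (- 1) ^ s * h s)
      = (\<Sum>a<m. \<Sum>t<p ^ N. (- 1) ^ a * ((- 1) ^ t * h (t + a * p ^ N)))"
    unfolding sum_lessThan_mult
    using \<open>odd p\<close> by (intro sum.cong refl) (simp add: power_add mult_ac minus_one_power_iff)
  moreover have "(\<Sum>t<p ^ N. (- 1) ^ t * h t)
      = (\<Sum>a<m. \<Sum>t<p ^ N. (- 1) ^ a * ((- 1) ^ t * h t))"
    unfolding sum_distrib_left[symmetric] sum_distrib_right[symmetric]
    by (simp add: sum_power_minus1_odd[OF \<open>odd m\<close>])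
  ultimately have "(\<Sum>s<m * p ^ N. (- 1) ^ s * h s) - (\<Sum>t<p ^ N. (- 1) ^ t * h t)
      = (\<Sum>a<m. \<Sum>t<p ^ N. (- 1) ^ a * ((- 1) ^ t * (h (t + a * p ^ N) - h t)))"
    by (simp add: sum_subtractf right_diff_distrib)
  also have "absval \<dots> \<le> C"
    using h C by (intro absval_sum_le) (auto simp: absval_mult)
  finally show ?thesis .
qed

text \<open>The limit is fixed before m is chosen, so that the sums up to p^N and up to d p^N share
  it.\<close>

lemma alternating_sum_converges:
  fixes h :: "nat \<Rightarrow> 'a"
  assumes h: "\<And>t s N. absval (h (t + s * p ^ N) - h t) \<le> C * (1 / real p) ^ N" and "odd p"
  obtains \<tau> where "\<And>m. odd m \<Longrightarrow> (\<lambda>N. \<Sum>s<m * p ^ N. (- 1) ^ s * h s) \<longlonglongrightarrow> \<tau>"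
proof -
  define T where "T M = (\<Sum>s<M. (- 1) ^ s * h s)" for M
  have diff: "absval (T (m * p ^ N) - T (p ^ N)) \<le> C * (1 / real p) ^ N" if "odd m" for m N
    unfolding T_def by (rule absval_alternating_sum_diff_le[OF h \<open>odd p\<close> that])
  \<comment> \<open>For m = p the comparison concerns the consecutive exponents N and N + 1; the
    differences are summable and telescope.\<close>
  have "summable (\<lambda>N. T (p ^ Suc N) - T (p ^ N))"
    using diff[OF \<open>odd p\<close>] prime_gt_1_nat[OF prime_p]
    by (intro summable_geometric_bound[where C = C and \<theta> = "1 / real p"]) auto
  hence "(\<lambda>N. (\<Sum>i<N. T (p ^ Suc i) - T (p ^ i)) + T (p ^ 0))
      \<longlonglongrightarrow> (\<Sum>N. T (p ^ Suc N) - T (p ^ N)) + T (p ^ 0)"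
    by (intro tendsto_add tendsto_const summable_LIMSEQ)
  then obtain \<tau> where \<tau>: "(\<lambda>N. T (p ^ N)) \<longlonglongrightarrow> \<tau>"
    unfolding sum_lessThan_telescope[of "\<lambda>N. T (p ^ N)"] diff_add_cancel by blast
  have "(\<lambda>N. T (m * p ^ N)) \<longlonglongrightarrow> \<tau>" if "odd m" for m
  proof -
    have "(\<lambda>N. T (m * p ^ N) - T (p ^ N)) \<longlonglongrightarrow> 0"
      by (rule tendsto_geometric_bound[where C = C and \<theta> = "1 / real p"])
        (use diff[OF that] prime_gt_1_nat[OF prime_p] in auto)
    from tendsto_add[OF this \<tau>] show ?thesis by simp
  qed
  thus thesis using that unfolding T_def by blast
qed

text \<open>1 + q = 2 + (q - 1), and |2| = 1 for odd p. This keeps the denominators 1 + q^m away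
  from 0.\<close>

lemma absval_1_plus:
  assumes "odd p" and q: "absval (1 - q :: 'a) < exp_radius p"
  shows "absval (1 + q) = 1"
proof -
  have "\<not> p dvd 2"
    using \<open>odd p\<close> prime_gt_1_nat[OF prime_p] by (cases "p = 2") (auto dest!: dvd_imp_le)
  hence "absval (2 :: 'a) = 1" using absval_of_nat_eq_1[of 2] by simp
  thus ?thesis
    using absval_add_eq[of "q - 1" 2] q exp_radius_less_1
    by (simp add: absval_minus_commute[of q 1] algebra_simps)
qed

text \<open>For odd p^N the normalising factor is (1 + q) / (1 + q^(p^N)), and q^(p^N) tends to 1
  because |p^N| tends to 0.\<close>

lemma fermionic_integral_eq:
  fixes q :: 'a
  assumes "odd p" and q: "absval (1 - q) < exp_radius p"
    and f: "\<And>t. f (of_nat t) * (- q) ^ t = (- 1) ^ t * h t"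
    and h: "(\<lambda>N. \<Sum>t<p ^ N. (- 1) ^ t * h t) \<longlonglongrightarrow> \<tau>"
  shows "fermionic_integral p q f = (1 + q) / 2 * \<tau>"
proof -
  have nz: "1 + q ^ m \<noteq> 0" for m
    using absval_1_plus[OF \<open>odd p\<close> absval_1_minus_power_less[OF q], of m] by auto
  have recip: "1 / qnumber_neg q (p ^ N) = (1 + q) / (1 + q ^ (p ^ N))" for N
    using \<open>odd p\<close> by (simp add: qnumber_neg_def)
  have "absval (1 / qnumber_neg q (p ^ N) - (1 + q) / 2) \<le> 1 * (1 / real p) ^ N" for N
  proof -
    have "1 / qnumber_neg q (p ^ N) - (1 + q) / 2
        = (1 + q) * (1 - q ^ (p ^ N)) / ((1 + 1) * (1 + q ^ (p ^ N)))"
      unfolding recip using nz[of "p ^ N"] by (simp add: divide_simps) (simp add: algebra_simps)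
    \<comment> \<open>2 is written 1 + 1 so that \<open>absval_1_plus\<close> at q = 1 applies; all
      factors except 1 - q^(p^N) then have absolute value 1.\<close>
    moreover have "absval (1 + 1 :: 'a) = 1"
      using exp_radius_pos by (intro absval_1_plus[OF \<open>odd p\<close>]) simp
    ultimately have "absval (1 / qnumber_neg q (p ^ N) - (1 + q) / 2) = absval (1 - q ^ (p ^ N))"
      by (simp only: absval_divide absval_mult mult_1 div_by_1 absval_1_plus[OF \<open>odd p\<close> q]
          absval_1_plus[OF \<open>odd p\<close> absval_1_minus_power_less[OF q]])
    also have "\<dots> = absval (qpow q (of_nat (p ^ N)) - 1)"
      by (simp only: qpow_of_nat[OF q] absval_minus_commute)
    also have "\<dots> \<le> absval (of_nat (p ^ N) :: 'a)"
      by (intro absval_qpow_minus_1_le[OF q] absval_of_nat_le_1)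
    finally show ?thesis unfolding absval_of_nat_prime_power by simp
  qed
  hence "(\<lambda>N. 1 / qnumber_neg q (p ^ N)) \<longlonglongrightarrow> (1 + q) / 2"
    by (rule tendsto_geometric_bound) (use prime_gt_1_nat[OF prime_p] in auto)
  from tendsto_mult_ultrametric[OF this h] show ?thesis
    unfolding fermionic_integral_def f by (rule limI)
qed

section \<open>Genocchi polynomials and their multiplication formula\<close>

lemma q_genocchi_eq:
  fixes q y :: 'a
  assumes "odd p" and q: "absval (1 - q) < exp_radius p"
    and lim: "(\<lambda>N. \<Sum>t<p ^ N. (- 1) ^ t * qnumber (q ^ \<alpha>) (y + of_nat t) ^ k) \<longlonglongrightarrow> \<tau>"
  shows "q_genocchi p \<alpha> \<beta> q (Suc k) y = of_nat (Suc k) * ((1 + q ^ \<beta>) / 2 * \<tau>)"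
proof -
  \<comment> \<open>\<open>z\<close> stands for the power of the q-number. At natural t the weight
    is the inverse of q^(\<beta> t), the power in the measure.\<close>
  have "qpow q (- (of_nat \<beta> * of_nat t)) * z * (- (q ^ \<beta>)) ^ t = (- 1) ^ t * z" for t z
  proof -
    have "(- (q ^ \<beta>)) ^ t = (- 1) ^ t * q ^ (\<beta> * t)"
      by (simp add: power_minus[of "q ^ \<beta>"] power_mult)
    thus ?thesis
      using qpow_minus_of_nat[OF q, of "\<beta> * t"] by (simp add: mult_ac)
  qed
  from fermionic_integral_eq[OF \<open>odd p\<close> absval_1_minus_power_less[OF q] this lim]
  show ?thesis by simp
qed

text \<open>The bound on d x puts all arguments d x + s of the left side in the unit disc; the
  arguments x + a/d + t of the right side come there after multiplication by d.\<close>

lemma q_genocchi_multiplication: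
  fixes q x :: 'a
  assumes "odd p" and q: "absval (1 - q) < exp_radius p" and "odd d"
    and x: "absval (of_nat d * x) \<le> 1"
  shows "q_genocchi p \<alpha> \<beta> q (Suc k) (of_nat d * x) =
    qnumber (q ^ \<alpha>) (of_nat d) ^ k / qnumber_neg (q ^ \<beta>) d *
    (\<Sum>a<d. (- 1) ^ a * q_genocchi p \<alpha> \<beta> (q ^ d) (Suc k) (x + of_nat a / of_nat d))"
proof -
  have d: "d > 0" using \<open>odd d\<close> by (rule odd_pos)
  have q\<alpha>: "absval (1 - q ^ \<alpha>) < exp_radius p" and qd: "absval (1 - q ^ d) < exp_radius p"
    by (rule absval_1_minus_power_less[OF q])+
  define D where "D = qnumber (q ^ \<alpha>) (of_nat d) ^ k"
  have D: "D \<noteq> 0" using qnumber_of_nat_neq_0[OF q\<alpha> d] by (simp add: D_def)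
  \<comment> \<open>\<open>g\<close> and \<open>h a\<close> are the integrands of the two sides once
    weight and measure have cancelled up to sign.\<close>
  define g where "g s = qnumber (q ^ \<alpha>) (of_nat d * x + of_nat s) ^ k" for s
  define h where "h a t = qnumber ((q ^ d) ^ \<alpha>) (x + of_nat a / of_nat d + of_nat t) ^ k" for a t
  have g_h: "g (a + d * t) = D * h a t" for a t
  proof -
    have "of_nat d * x + of_nat (a + d * t)
        = of_nat d * (x + of_nat a / of_nat d + of_nat t :: 'a)"
      using d by (simp add: distrib_left)
    moreover have "(q ^ \<alpha>) ^ d = (q ^ d) ^ \<alpha>"
      by (simp add: power_mult[symmetric] mult.commute)
    ultimately show ?thesis
      by (simp only: g_def h_def D_def qnumber_mult[OF q\<alpha> d] power_mult_distrib)
  qed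
  obtain C where C: "C \<ge> 0" and lip: "\<And>y h. absval y \<le> 1 \<Longrightarrow> absval h \<le> 1 \<Longrightarrow>
      absval (qnumber (q ^ \<alpha>) (y + h) ^ k - qnumber (q ^ \<alpha>) y ^ k) \<le> C * absval h"
    using qnumber_power_lipschitz[OF q\<alpha>] by blast
  have g: "absval (g (t + s * p ^ N) - g t) \<le> C * (1 / real p) ^ N" for t s N
  proof -
    have "absval (g (t + s * p ^ N) - g t) \<le> C * absval (of_nat (s * p ^ N) :: 'a)"
      unfolding g_def of_nat_add add.assoc[symmetric]
      by (intro lip absval_add_leI x absval_of_nat_le_1)
    also have "\<dots> \<le> C * absval (of_nat (p ^ N) :: 'a)"
      unfolding of_nat_mult using C by (intro mult_left_mono absval_of_nat_mult_le)
    finally show ?thesis unfolding absval_of_nat_prime_power .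
  qed
  obtain \<tau> where \<tau>: "\<And>m. odd m \<Longrightarrow> (\<lambda>N. \<Sum>s<m * p ^ N. (- 1) ^ s * g s) \<longlonglongrightarrow> \<tau>"
    using alternating_sum_converges[OF g \<open>odd p\<close>] by blast
  \<comment> \<open>The Lipschitz bound does not apply to \<open>h a\<close> directly, since x + a/d
    may lie outside the unit disc; it is transferred from \<open>g\<close> by division by
    \<open>D\<close>.\<close>
  have "\<exists>\<tau>'. (\<lambda>N. \<Sum>t<p ^ N. (- 1) ^ t * h a t) \<longlonglongrightarrow> \<tau>'" for a
  proof -
    have "absval (h a (t + s * p ^ N) - h a t) \<le> C / absval D * (1 / real p) ^ N" for t s N
    proof -
      \<comment> \<open>A shift of t by s p^N in \<open>h a\<close> is a shift by d s p^N in
        \<open>g\<close>, again a multiple of p^N.\<close>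
      have "D * (h a (t + s * p ^ N) - h a t) = g (a + d * t + (d * s) * p ^ N) - g (a + d * t)"
        using g_h[of a "t + s * p ^ N"] g_h[of a t] by (simp add: algebra_simps)
      with g have "absval (D * (h a (t + s * p ^ N) - h a t)) \<le> C * (1 / real p) ^ N"
        by metis
      hence "absval (h a (t + s * p ^ N) - h a t) * absval D \<le> C * (1 / real p) ^ N"
        by (simp only: absval_mult mult.commute)
      moreover have "absval D > 0" using D absval_nonneg[of D] by (simp add: less_le)
      ultimately show ?thesis by (simp add: pos_le_divide_eq)
    qed
    from alternating_sum_converges[OF this \<open>odd p\<close>] obtain \<tau>' where
      "\<And>m. odd m \<Longrightarrow> (\<lambda>N. \<Sum>t<m * p ^ N. (- 1) ^ t * h a t) \<longlonglongrightarrow> \<tau>'" by blast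
    from this[of 1] show ?thesis by auto
  qed
  then obtain \<tau>' where \<tau>': "\<And>a. (\<lambda>N. \<Sum>t<p ^ N. (- 1) ^ t * h a t) \<longlonglongrightarrow> \<tau>' a" by metis
  have "(\<lambda>N. \<Sum>a<d. (- 1) ^ a * (D * (\<Sum>t<p ^ N. (- 1) ^ t * h a t)))
      \<longlonglongrightarrow> (\<Sum>a<d. (- 1) ^ a * (D * \<tau>' a))"
    by (intro tendsto_sum tendsto_mult_ultrametric tendsto_const \<tau>')
  moreover have "(\<Sum>a<d. (- 1) ^ a * (D * (\<Sum>t<p ^ N. (- 1) ^ t * h a t)))
      = (\<Sum>s<d * p ^ N. (- 1) ^ s * g s)" for N
  proof -
    \<comment> \<open>With s = a + t d and d odd, the sign (-1)^s splits as (-1)^a (-1)^t.\<close>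
    have "(\<Sum>s<d * p ^ N. (- 1) ^ s * g s)
        = (\<Sum>t<p ^ N. \<Sum>a<d. (- 1) ^ (a + t * d) * g (a + t * d))"
      by (subst mult.commute) (rule sum_lessThan_mult)
    also have "\<dots> = (\<Sum>t<p ^ N. \<Sum>a<d. (- 1) ^ a * (D * ((- 1) ^ t * h a t)))"
      using \<open>odd d\<close> g_h
      by (intro sum.cong refl) (simp add: power_add mult_ac minus_one_power_iff)
    also have "\<dots> = (\<Sum>a<d. (- 1) ^ a * (D * (\<Sum>t<p ^ N. (- 1) ^ t * h a t)))"
      by (subst sum.swap) (simp add: sum_distrib_left)
    finally show ?thesis ..
  qed
  ultimately have \<tau>_sum: "(\<Sum>a<d. (- 1) ^ a * (D * \<tau>' a)) = \<tau>"
    using LIMSEQ_unique \<tau>[OF \<open>odd d\<close>] by force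
  have lhs: "q_genocchi p \<alpha> \<beta> q (Suc k) (of_nat d * x)
      = of_nat (Suc k) * ((1 + q ^ \<beta>) / 2 * \<tau>)"
    by (rule q_genocchi_eq[OF \<open>odd p\<close> q]) (use \<tau>[of 1] in \<open>simp add: g_def\<close>)
  have rhs: "q_genocchi p \<alpha> \<beta> (q ^ d) (Suc k) (x + of_nat a / of_nat d)
      = of_nat (Suc k) * ((1 + (q ^ d) ^ \<beta>) / 2 * \<tau>' a)" for a
    by (rule q_genocchi_eq[OF \<open>odd p\<close> qd]) (use \<tau>'[of a] in \<open>simp add: h_def\<close>)
  have nz: "1 + q ^ m \<noteq> 0" for m
    using absval_1_plus[OF \<open>odd p\<close> absval_1_minus_power_less[OF q], of m] by auto
  \<comment> \<open>For odd d the denominator is (1 + q^(\<beta> d)) / (1 + q^\<beta>); it converts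
    the constant of the integrals to base q^d into that of the left side.\<close>
  have neg: "1 / qnumber_neg (q ^ \<beta>) d * (1 + (q ^ d) ^ \<beta>) = 1 + q ^ \<beta>"
    using nz[of \<beta>] nz[of "\<beta> * d"] \<open>odd d\<close>
    by (simp add: qnumber_neg_def power_mult[symmetric] mult.commute[of d])
  have "D / qnumber_neg (q ^ \<beta>) d *
      (\<Sum>a<d. (- 1) ^ a * q_genocchi p \<alpha> \<beta> (q ^ d) (Suc k) (x + of_nat a / of_nat d))
      = of_nat (Suc k) * ((1 / qnumber_neg (q ^ \<beta>) d * (1 + (q ^ d) ^ \<beta>)) / 2
          * (\<Sum>a<d. (- 1) ^ a * (D * \<tau>' a)))"
    unfolding rhs sum_distrib_left by (intro sum.cong refl) (simp add: mult_ac)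
  also have "\<dots> = q_genocchi p \<alpha> \<beta> q (Suc k) (of_nat d * x)"
    unfolding neg \<tau>_sum lhs ..
  finally show ?thesis unfolding D_def ..
qed

end

theorem theorem5:
  fixes p d n \<alpha> \<beta> :: nat
    and q x :: "'a::complete_ultrametric_field"
  assumes "padic_complex_field TYPE('a) p"
    and "odd p"
    and "absval (1 - q) < real p powr (- 1 / (real p - 1))"
    and "odd d"
    and "n \<ge> 1"
    and "absval (of_nat d * x) \<le> 1"
  shows "q_genocchi p \<alpha> \<beta> q n (of_nat d * x) =
    qnumber (q ^ \<alpha>) (of_nat d) ^ (n - 1) / qnumber_neg (q ^ \<beta>) d *
    (\<Sum>a<d. (- 1) ^ a * q_genocchi p \<alpha> \<beta> (q ^ d) n (x + of_nat a / of_nat d))"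
  using padic_complex_field.q_genocchi_multiplication[OF assms(1,2) _ assms(4,6),
      of q \<alpha> \<beta> "n - 1"] assms(3,5)
  by (simp add: exp_radius_def)

end
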